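(* Let an ontic representation with ontic set $\Lambda$ be given, with valuation $1$-forms $\xi_{\lambda'}$ on $\mathcal{M}_{\mathcal{E}}$ (effects), $\Gamma_{\lambda'\lambda}$ on $\mathcal{M}_{\mathcal{T}}$ (transformations) and $\mu_{\lambda}$ on $\mathcal{M}_{\mathcal{P}}$ (states), where $\lambda,\lambda'\in\Lambda$. If the first de Rham cohomology group $H^1$ (of each of the spaces $\mathcal{M}_{\mathcal{E}},\mathcal{M}_{\mathcal{T}},\mathcal{M}_{\mathcal{P}}$) is trivial and the contextual curvature vanishes, $F=0$, for every valuation $1$-form, then the ontic representation is noncontextual.
   Context: Generalized probability theory and ontic representation. A generalized probability theory has sets of states $\mathcal{P}$, transformations $\mathcal{T}$ and effects $\mathcal{E}$, each a convex subset of a finite-dimensional real vector space, and probabilities $p(E|T,P)\in[0,1]$. An ontic representation consists of a set $\Lambda$ of ontic (hidden) variables and valuation functions $\xi,\Gamma,\mu$, with values in $[0,1]$ on $\mathcal{E},\mathcal{T},\mathcal{P}$ respectively, such that $p(E|T,P)=\sum_{\lambda,\lambda'}\xi(E|\lambda')\,\Gamma(\lambda',T,\lambda)\,\mu(\lambda|P)$. Geometric encoding. For each $X\in\{\mathcal{E},\mathcal{T},\mathcal{P}\}$ there is a space $\mathcal{M}_X$, with possibly non-trivial topology, which is either a piecewise linear manifold given as an oriented simplicial complex (discrete case) or a smooth manifold (continuous case). $\mathcal{C}_n(\mathcal{M}_X)$ denotes its $n$-chains with real coefficients (simplicial chains, respectively smooth singular chains) with boundary operator $\partial$, and $\mathcal{C}^n(\mathcal{M}_X)$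 denotes its $n$-forms (linear functionals on $\mathcal{C}_n$, respectively smooth differential $n$-forms) with coboundary operator $d$ (the exterior derivative in the smooth case). The pairing is $\langle\omega|S\rangle=\int_S\omega\in\mathbb{R}$ for an $n$-form $\omega$ and an $n$-chain $S$, and it satisfies Stokes' theorem $\langle\omega|\partial S\rangle=\langle d\omega|S\rangle$. The first de Rham cohomology group is $H^1(\mathcal{M}_X)=\{\text{closed }1\text{-forms}\}/\{\text{exact }1\text{-forms}\}=\ker(d:\mathcal{C}^1\to\mathcal{C}^2)/\operatorname{im}(d:\mathcal{C}^0\to\mathcal{C}^1)$. Objects (effects, transformations, states) are vectors, viewed as oriented $1$-dimensional pieces of $\mathcal{M}_X$, i.e. as $1$-chains $|E\rangle,|T\rangle,|P\rangle$. The valuation functions are $1$-forms: $\xi(E|\lambda')=\langle\xi_{\lambda'}|E\rangle$, $\Gamma(\lambda',T,\lambda)=\langle\Gamma_{\lambda'\lambda}|T\rangle$, $\mu(\lambda|P)=\langle\mu_{\lambda}|P\rangle$. Noncontextuality. A loop is a $1$-chain $\gamma$ with $\partial\gamma=0$. Operational equivalences (linear relations such as $\sum_r b_rE_r=0$ among objects) are identified with loops ($\gamma=\sum_r b_r|E_r\rangle$), and every loop is regarded as an operational equivalence. The representation is noncontextual if every valuation $1$-form $v$ (each $\xi_{\lambda'}$, $\Gamma_{\lambda'\lambda}$, $\mu_\lambda$) has zero phase $\langle v|\gamma\rangle=0$ along every loop $\gamma$ in the space on which it is defined. Curvature. Each valuation $1$-form $v$ is written $v=dc+\omega$, with $c$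 a function ($0$-form) on the corresponding space $\mathcal{M}_X$ and $\omega$ a $1$-form (the contextual connection). Its contextual curvature is $F=d\omega=dv$. *)

theory Defs
  imports "HOL-Analysis.Analysis" "HOL-Algebra.Elementary_Groups" "HOL-Combinatorics.Permutations"
begin

definition omit :: "nat \<Rightarrow> 'x list \<Rightarrow> 'x list" where
  "omit i xs = take i xs @ drop (Suc i) xs"


section \<open>Discrete case: piecewise linear manifolds as oriented simplicial complexes\<close>

text \<open>The library notion \<^const>\<open>simplicial_complex\<close> with finiteness relaxed to local
  finiteness, so that non-compact polyhedra are included.\<close>

definition locally_finite_complex :: "'a::euclidean_space set set \<Rightarrow> bool" where
  "locally_finite_complex K \<longleftrightarrow>
     (\<forall>S\<in>K. \<exists>n. n simplex S) \<and>
     (\<forall>F S. S \<in> K \<and> F face_of S \<longrightarrow> F \<in> K) \<and>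
     (\<forall>S S'. S \<in> K \<and> S' \<in> K \<longrightarrow> (S \<inter> S') face_of S) \<and>
     (\<forall>x\<in>\<Union>K. \<exists>U. open U \<and> x \<in> U \<and> finite {S \<in> K. S \<inter> U \<noteq> {}})"

definition piecewise_affine_on ::
    "'a::euclidean_space set \<Rightarrow> ('a \<Rightarrow> 'b::euclidean_space) \<Rightarrow> bool" where
  "piecewise_affine_on S f \<longleftrightarrow>
     (\<exists>Q. finite Q \<and> (\<forall>q\<in>Q. polytope q) \<and> \<Union>Q = S \<and>
          (\<forall>q\<in>Q. \<exists>A b. linear A \<and> (\<forall>x\<in>q. f x = A x + b)))"

text \<open>Every point has a neighbourhood that is piecewise linearly homeomorphic to a closed
  simplex of a fixed dimension.  The point may be mapped to the boundary of that simplex, so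
  manifolds with boundary are included.\<close>

definition pl_manifold :: "'a::euclidean_space set \<Rightarrow> bool" where
  "pl_manifold M \<longleftrightarrow>
     (\<exists>n::nat. \<forall>x\<in>M. \<exists>U N T f g.
        openin (top_of_set M) U \<and> x \<in> U \<and> U \<subseteq> N \<and> N \<subseteq> M \<and>
        int n simplex (T :: 'a set) \<and> homeomorphism N T f g \<and> piecewise_affine_on N f)"

text \<open>An orientation lists the vertices of each simplex; only the list up to even
  permutations matters.\<close>

definition complex_orientation :: "'a::euclidean_space set set \<Rightarrow> ('a set \<Rightarrow> 'a list) \<Rightarrow> bool" where
  "complex_orientation K ori \<longleftrightarrow>
     (\<forall>S\<in>K. distinct (ori S) \<and> set (ori S) = {x. x extreme_point_of S})"

definition oriented_pl_manifold :: "'a::euclidean_space set set \<Rightarrow> ('a set \<Rightarrow> 'a list) \<Rightarrow> bool" where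
  "oriented_pl_manifold K ori \<longleftrightarrow>
     locally_finite_complex K \<and> complex_orientation K ori \<and> pl_manifold (\<Union>K)"

text \<open>A chain is given by its coefficients with respect to the basis of positively oriented
  simplices.\<close>

definition simplicial_chains :: "'a::euclidean_space set set \<Rightarrow> nat \<Rightarrow> ('a set \<Rightarrow> real) set" where
  "simplicial_chains K n =
     {c. finite {S. c S \<noteq> 0} \<and> (\<forall>S. c S \<noteq> 0 \<longrightarrow> S \<in> K \<and> int n simplex S)}"

definition relabelling :: "'x list \<Rightarrow> 'x list \<Rightarrow> 'x \<Rightarrow> 'x" where
  "relabelling xs ys x = (case map_of (zip xs ys) x of None \<Rightarrow> x | Some y \<Rightarrow> y)"

text \<open>The chain $[x_0, \ldots, x_n]$: plus or minus the basis element of the simplex with these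
  vertices, the sign comparing the given vertex order with the chosen orientation.\<close>

definition ordered_simplex_chain ::
    "('a::euclidean_space set \<Rightarrow> 'a list) \<Rightarrow> 'a list \<Rightarrow> 'a set \<Rightarrow> real" where
  "ordered_simplex_chain ori xs =
     (\<lambda>S. if S = convex hull (set xs) then of_int (sign (relabelling xs (ori S))) else 0)"

text \<open>Used on chains of positive degree only.\<close>

definition simplicial_boundary ::
    "('a::euclidean_space set \<Rightarrow> 'a list) \<Rightarrow> ('a set \<Rightarrow> real) \<Rightarrow> 'a set \<Rightarrow> real" where
  "simplicial_boundary ori c =
     (\<lambda>F. \<Sum>S | c S \<noteq> 0. c S *
        (\<Sum>i<length (ori S). (-1) ^ i * ordered_simplex_chain ori (omit i (ori S)) F))"

text \<open>Linear functionals on the space of chains.  They are set to 0 off that space, so that equal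
  functionals are equal functions.\<close>

definition simplicial_cochains ::
    "'a::euclidean_space set set \<Rightarrow> nat \<Rightarrow> (('a set \<Rightarrow> real) \<Rightarrow> real) set" where
  "simplicial_cochains K n =
     {w. (\<forall>c\<in>simplicial_chains K n. \<forall>c'\<in>simplicial_chains K n. \<forall>a b.
            w (\<lambda>S. a * c S + b * c' S) = a * w c + b * w c') \<and>
         (\<forall>c. c \<notin> simplicial_chains K n \<longrightarrow> w c = 0)}"

definition simplicial_coboundary ::
    "'a::euclidean_space set set \<Rightarrow> ('a set \<Rightarrow> 'a list) \<Rightarrow> nat \<Rightarrow>
     (('a set \<Rightarrow> real) \<Rightarrow> real) \<Rightarrow> ('a set \<Rightarrow> real) \<Rightarrow> real" where
  "simplicial_coboundary K ori n w =
     (\<lambda>c. if c \<in> simplicial_chains K (Suc n) then w (simplicial_boundary ori c) else 0)"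


section \<open>Continuous case: smooth manifolds\<close>

primrec Ck_on :: "nat \<Rightarrow> ('e::real_normed_vector \<Rightarrow> 'f::real_normed_vector) \<Rightarrow> 'e set \<Rightarrow> bool" where
  "Ck_on 0 f S \<longleftrightarrow> continuous_on S f"
| "Ck_on (Suc k) f S \<longleftrightarrow>
     (\<forall>x\<in>S. f differentiable (at x)) \<and> (\<forall>v. Ck_on k (\<lambda>x. frechet_derivative f (at x) v) S)"

text \<open>Used for open sets \<open>S\<close> in finite-dimensional spaces.\<close>

definition smooth_on :: "('e::real_normed_vector \<Rightarrow> 'f::real_normed_vector) \<Rightarrow> 'e set \<Rightarrow> bool" where
  "smooth_on f S \<longleftrightarrow> (\<forall>k. Ck_on k f S)"

text \<open>A chart is a pair of its domain and its coordinate map; values of the map off the domain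
  are irrelevant.\<close>

type_synonym ('m, 'e) chart = "'m set \<times> ('m \<Rightarrow> 'e)"

definition chart_image :: "('m, 'e) chart \<Rightarrow> 'e set" where
  "chart_image h = snd h ` fst h"

definition transition :: "('m, 'e) chart \<Rightarrow> ('m, 'e) chart \<Rightarrow> 'e \<Rightarrow> 'e" where
  "transition h h' = snd h' \<circ> inv_into (fst h) (snd h)"

definition smooth_manifold :: "'m topology \<Rightarrow> ('m, 'e::euclidean_space) chart set \<Rightarrow> bool" where
  "smooth_manifold X A \<longleftrightarrow>
     Hausdorff_space X \<and> second_countable X \<and>
     (\<Union>h\<in>A. fst h) = topspace X \<and>
     (\<forall>h\<in>A. openin X (fst h) \<and> open (chart_image h) \<and>
        homeomorphic_map (subtopology X (fst h)) (top_of_set (chart_image h)) (snd h)) \<and>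
     (\<forall>h\<in>A. \<forall>h'\<in>A. smooth_on (transition h h') (snd h ` (fst h \<inter> fst h')))"

text \<open>A differential \<open>n\<close>-form is given by its local expressions in the charts of the atlas, which
  must be related by pullback along the transition maps.  A local expression takes a point in
  coordinates and a list of \<open>n\<close> tangent vectors in coordinates; in particular, a 0-form is a smooth
  function, with value \<open>\<alpha> h x []\<close> at the point with coordinates \<open>x\<close> in the chart \<open>h\<close>.  Local
  expressions are 0 on irrelevant arguments, so that equal forms are equal functions.\<close>

definition smooth_forms ::
    "('m, 'e::euclidean_space) chart set \<Rightarrow> nat \<Rightarrow> (('m, 'e) chart \<Rightarrow> 'e \<Rightarrow> 'e list \<Rightarrow> real) set" where
  "smooth_forms A n =
     {\<alpha>. (\<forall>h x vs. \<alpha> h x vs \<noteq> 0 \<longrightarrow> h \<in> A \<and> x \<in> chart_image h \<and> length vs = n) \<and>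
         (\<forall>h\<in>A. \<forall>vs. smooth_on (\<lambda>x. \<alpha> h x vs) (chart_image h)) \<and>
         (\<forall>h\<in>A. \<forall>x\<in>chart_image h. \<forall>vs. length vs = n \<longrightarrow>
            (\<forall>i<n. linear (\<lambda>v. \<alpha> h x (vs[i := v]))) \<and>
            (\<forall>i<n. \<forall>j<n. i \<noteq> j \<and> vs ! i = vs ! j \<longrightarrow> \<alpha> h x vs = 0)) \<and>
         (\<forall>h\<in>A. \<forall>h'\<in>A. \<forall>x\<in>snd h ` (fst h \<inter> fst h'). \<forall>vs.
            \<alpha> h x vs =
            \<alpha> h' (transition h h' x) (map (frechet_derivative (transition h h') (at x)) vs))}"

text \<open>In coordinates,
  $(d\alpha)_x(v_0, \ldots, v_n) = \sum_i (-1)^i \, D_{v_i} \alpha_x(v_0, \ldots, \widehat{v_i}, \ldots, v_n)$.\<close>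

definition exterior_derivative ::
    "('m, 'e::euclidean_space) chart set \<Rightarrow>
     (('m, 'e) chart \<Rightarrow> 'e \<Rightarrow> 'e list \<Rightarrow> real) \<Rightarrow> ('m, 'e) chart \<Rightarrow> 'e \<Rightarrow> 'e list \<Rightarrow> real" where
  "exterior_derivative A \<alpha> =
     (\<lambda>h x vs. if h \<in> A \<and> x \<in> chart_image h
        then \<Sum>i<length vs. (-1) ^ i * frechet_derivative (\<lambda>y. \<alpha> h y (omit i vs)) (at x) (vs ! i)
        else 0)"

text \<open>Smooth singular 1-simplices, the standard 1-simplex being identified with the unit interval.
  Smoothness at the end points means the existence of a local smooth extension.\<close>

definition smooth_singular_simplex1 ::
    "'m topology \<Rightarrow> ('m, 'e::euclidean_space) chart set \<Rightarrow> (real \<Rightarrow> 'm) \<Rightarrow> bool" where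
  "smooth_singular_simplex1 X A \<sigma> \<longleftrightarrow>
     \<sigma> \<in> extensional {0..1} \<and> \<sigma> ` {0..1} \<subseteq> topspace X \<and>
     (\<forall>t\<in>{0..1}. \<exists>h\<in>A. \<exists>J g. open J \<and> t \<in> J \<and> \<sigma> ` (J \<inter> {0..1}) \<subseteq> fst h \<and>
        smooth_on g J \<and> (\<forall>s\<in>J \<inter> {0..1}. g s = snd h (\<sigma> s)))"

definition smooth_chains1 ::
    "'m topology \<Rightarrow> ('m, 'e::euclidean_space) chart set \<Rightarrow> ((real \<Rightarrow> 'm) \<Rightarrow> real) set" where
  "smooth_chains1 X A =
     {c. finite {\<sigma>. c \<sigma> \<noteq> 0} \<and> (\<forall>\<sigma>. c \<sigma> \<noteq> 0 \<longrightarrow> smooth_singular_simplex1 X A \<sigma>)}"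

definition singular_boundary1 :: "((real \<Rightarrow> 'm) \<Rightarrow> real) \<Rightarrow> 'm \<Rightarrow> real" where
  "singular_boundary1 c =
     (\<lambda>x. \<Sum>\<sigma> | c \<sigma> \<noteq> 0. c \<sigma> * (of_bool (\<sigma> 1 = x) - of_bool (\<sigma> 0 = x)))"

text \<open>The integral of the pullback; the integrand does not depend on the chosen charts.\<close>

definition form_integral1 ::
    "('m, 'e::euclidean_space) chart set \<Rightarrow>
     (('m, 'e) chart \<Rightarrow> 'e \<Rightarrow> 'e list \<Rightarrow> real) \<Rightarrow> (real \<Rightarrow> 'm) \<Rightarrow> real" where
  "form_integral1 A \<alpha> \<sigma> =
     integral {0..1} (\<lambda>t.
       let h = (SOME h. h \<in> A \<and> \<sigma> t \<in> fst h)
       in \<alpha> h (snd h (\<sigma> t)) [vector_derivative (snd h \<circ> \<sigma>) (at t within {0..1})])"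


section \<open>Spaces of either kind, their 1-chains and forms\<close>

datatype ('a, 'm, 'e) geometry =
    Discrete "'a set set" "'a set \<Rightarrow> 'a list"
  | Continuous "'m topology" "('m, 'e) chart set"

datatype ('a, 'm) chain1 =
    Simplicial_Chain (simplicial_coeff: "'a set \<Rightarrow> real")
  | Singular_Chain (singular_coeff: "(real \<Rightarrow> 'm) \<Rightarrow> real")

datatype ('a, 'm, 'e) form =
    Simplicial_Form "('a set \<Rightarrow> real) \<Rightarrow> real"
  | Smooth_Form "('m, 'e) chart \<Rightarrow> 'e \<Rightarrow> 'e list \<Rightarrow> real"

fun geometric_space ::
    "('a::euclidean_space, 'm, 'e::euclidean_space) geometry \<Rightarrow> bool" where
  "geometric_space (Discrete K ori) \<longleftrightarrow> oriented_pl_manifold K ori"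
| "geometric_space (Continuous X A) \<longleftrightarrow> smooth_manifold X A"

fun chains1 ::
    "('a::euclidean_space, 'm, 'e::euclidean_space) geometry \<Rightarrow> ('a, 'm) chain1 set" where
  "chains1 (Discrete K ori) = Simplicial_Chain ` simplicial_chains K 1"
| "chains1 (Continuous X A) = Singular_Chain ` smooth_chains1 X A"

fun loops ::
    "('a::euclidean_space, 'm, 'e::euclidean_space) geometry \<Rightarrow> ('a, 'm) chain1 set" where
  "loops (Discrete K ori) =
     Simplicial_Chain ` {c \<in> simplicial_chains K 1. simplicial_boundary ori c = (\<lambda>_. 0)}"
| "loops (Continuous X A) =
     Singular_Chain ` {c \<in> smooth_chains1 X A. singular_boundary1 c = (\<lambda>_. 0)}"

fun linear_combination ::
    "('a, 'm, 'e) geometry \<Rightarrow> 'o set \<Rightarrow> ('o \<Rightarrow> real) \<Rightarrow> ('o \<Rightarrow> ('a, 'm) chain1) \<Rightarrow> ('a, 'm) chain1"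
  where
  "linear_combination (Discrete K ori) R b \<kappa> =
     Simplicial_Chain (\<lambda>s. \<Sum>r\<in>R. b r * simplicial_coeff (\<kappa> r) s)"
| "linear_combination (Continuous X A) R b \<kappa> =
     Singular_Chain (\<lambda>s. \<Sum>r\<in>R. b r * singular_coeff (\<kappa> r) s)"

fun forms ::
    "('a::euclidean_space, 'm, 'e::euclidean_space) geometry \<Rightarrow> nat \<Rightarrow> ('a, 'm, 'e) form set" where
  "forms (Discrete K ori) n = Simplicial_Form ` simplicial_cochains K n"
| "forms (Continuous X A) n = Smooth_Form ` smooth_forms A n"

text \<open>In the following functions, only arguments belonging to the same kind of space are used.\<close>

fun form_add :: "('a, 'm, 'e) form \<Rightarrow> ('a, 'm, 'e) form \<Rightarrow> ('a, 'm, 'e) form" where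
  "form_add (Simplicial_Form w) (Simplicial_Form w') = Simplicial_Form (\<lambda>c. w c + w' c)"
| "form_add (Smooth_Form \<alpha>) (Smooth_Form \<beta>) = Smooth_Form (\<lambda>h x vs. \<alpha> h x vs + \<beta> h x vs)"

fun form_zero :: "('a, 'm, 'e) geometry \<Rightarrow> ('a, 'm, 'e) form" where
  "form_zero (Discrete K ori) = Simplicial_Form (\<lambda>_. 0)"
| "form_zero (Continuous X A) = Smooth_Form (\<lambda>_ _ _. 0)"

fun differential ::
    "('a::euclidean_space, 'm, 'e::euclidean_space) geometry \<Rightarrow> nat \<Rightarrow>
     ('a, 'm, 'e) form \<Rightarrow> ('a, 'm, 'e) form" where
  "differential (Discrete K ori) n (Simplicial_Form w) =
     Simplicial_Form (simplicial_coboundary K ori n w)"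
| "differential (Continuous X A) n (Smooth_Form \<alpha>) = Smooth_Form (exterior_derivative A \<alpha>)"

fun pairing1 ::
    "('a::euclidean_space, 'm, 'e::euclidean_space) geometry \<Rightarrow>
     ('a, 'm, 'e) form \<Rightarrow> ('a, 'm) chain1 \<Rightarrow> real" where
  "pairing1 (Discrete K ori) (Simplicial_Form w) (Simplicial_Chain c) = w c"
| "pairing1 (Continuous X A) (Smooth_Form \<alpha>) (Singular_Chain c) =
     (\<Sum>\<sigma> | c \<sigma> \<noteq> 0. c \<sigma> * form_integral1 A \<alpha> \<sigma>)"

definition closed_forms1 ::
    "('a::euclidean_space, 'm, 'e::euclidean_space) geometry \<Rightarrow> ('a, 'm, 'e) form set" where
  "closed_forms1 M = {\<alpha> \<in> forms M 1. differential M 1 \<alpha> = form_zero M}"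

definition exact_forms1 ::
    "('a::euclidean_space, 'm, 'e::euclidean_space) geometry \<Rightarrow> ('a, 'm, 'e) form set" where
  "exact_forms1 M = differential M 0 ` forms M 0"

definition de_Rham_cohomology1 ::
    "('a::euclidean_space, 'm, 'e::euclidean_space) geometry \<Rightarrow> ('a, 'm, 'e) form set monoid" where
  "de_Rham_cohomology1 M =
     \<lparr>carrier = closed_forms1 M, monoid.mult = form_add, one = form_zero M\<rparr> Mod exact_forms1 M"


section \<open>Generalized probability theories and ontic representations\<close>

record ('o, 'a, 'm, 'e) encoding =
  objects :: "'o set"
  shape :: "('a, 'm, 'e) geometry"
  ket :: "'o \<Rightarrow> ('a, 'm) chain1"

text \<open>The last conjunct says that an operational equivalence among objects is a loop.\<close>

definition geometric_encoding ::
    "('o::euclidean_space, 'a::euclidean_space, 'm, 'e::euclidean_space) encoding \<Rightarrow> bool" where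
  "geometric_encoding G \<longleftrightarrow>
     geometric_space (shape G) \<and>
     ket G ` objects G \<subseteq> chains1 (shape G) \<and>
     (\<forall>R b. finite R \<and> R \<subseteq> objects G \<and> (\<Sum>r\<in>R. b r *\<^sub>R r) = 0 \<longrightarrow>
        linear_combination (shape G) R b (ket G) \<in> loops (shape G))"

definition generalized_probability_theory ::
    "'eff::euclidean_space set \<Rightarrow> 'tr::euclidean_space set \<Rightarrow> 'st::euclidean_space set \<Rightarrow>
     ('eff \<Rightarrow> 'tr \<Rightarrow> 'st \<Rightarrow> real) \<Rightarrow> bool" where
  "generalized_probability_theory Eff Tr St p \<longleftrightarrow>
     convex Eff \<and> convex Tr \<and> convex St \<and>
     (\<forall>E\<in>Eff. \<forall>T\<in>Tr. \<forall>P\<in>St. p E T P \<in> {0..1})"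

definition valuation ::
    "('o, 'a::euclidean_space, 'm, 'e::euclidean_space) encoding \<Rightarrow> ('a, 'm, 'e) form \<Rightarrow> 'o \<Rightarrow> real"
  where
  "valuation G v x = pairing1 (shape G) v (ket G x)"

definition valuation_form ::
    "('o, 'a::euclidean_space, 'm, 'e::euclidean_space) encoding \<Rightarrow> ('a, 'm, 'e) form \<Rightarrow> bool" where
  "valuation_form G v \<longleftrightarrow>
     v \<in> forms (shape G) 1 \<and> (\<forall>x\<in>objects G. valuation G v x \<in> {0..1})"

text \<open>The first index of \<open>\<Gamma>\<close> is the output ontic variable $\lambda'$, the second one the input
  ontic variable $\lambda$.\<close>

definition ontic_representation ::
    "('eff::euclidean_space, 'a1::euclidean_space, 'm1, 'e1::euclidean_space) encoding \<Rightarrow>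
     ('tr::euclidean_space, 'a2::euclidean_space, 'm2, 'e2::euclidean_space) encoding \<Rightarrow>
     ('st::euclidean_space, 'a3::euclidean_space, 'm3, 'e3::euclidean_space) encoding \<Rightarrow>
     ('eff \<Rightarrow> 'tr \<Rightarrow> 'st \<Rightarrow> real) \<Rightarrow> 'l set \<Rightarrow>
     ('l \<Rightarrow> ('a1, 'm1, 'e1) form) \<Rightarrow> ('l \<Rightarrow> 'l \<Rightarrow> ('a2, 'm2, 'e2) form) \<Rightarrow>
     ('l \<Rightarrow> ('a3, 'm3, 'e3) form) \<Rightarrow> bool" where
  "ontic_representation \<E> \<T> \<P> p \<Lambda> \<xi> \<Gamma> \<mu> \<longleftrightarrow>
     generalized_probability_theory (objects \<E>) (objects \<T>) (objects \<P>) p \<and>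
     geometric_encoding \<E> \<and> geometric_encoding \<T> \<and> geometric_encoding \<P> \<and>
     (\<forall>l'\<in>\<Lambda>. valuation_form \<E> (\<xi> l')) \<and>
     (\<forall>l'\<in>\<Lambda>. \<forall>l\<in>\<Lambda>. valuation_form \<T> (\<Gamma> l' l)) \<and>
     (\<forall>l\<in>\<Lambda>. valuation_form \<P> (\<mu> l)) \<and>
     (\<forall>E\<in>objects \<E>. \<forall>T\<in>objects \<T>. \<forall>P\<in>objects \<P>.
        ((\<lambda>(l', l). valuation \<E> (\<xi> l') E * valuation \<T> (\<Gamma> l' l) T * valuation \<P> (\<mu> l) P)
          has_sum p E T P) (\<Lambda> \<times> \<Lambda>))"

text \<open>Every loop counts as an operational equivalence, not only the linear combinations of kets.\<close>

definition zero_phase ::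
    "('o, 'a::euclidean_space, 'm, 'e::euclidean_space) encoding \<Rightarrow> ('a, 'm, 'e) form \<Rightarrow> bool" where
  "zero_phase G v \<longleftrightarrow> (\<forall>\<gamma>\<in>loops (shape G). pairing1 (shape G) v \<gamma> = 0)"

definition noncontextual ::
    "('eff, 'a1::euclidean_space, 'm1, 'e1::euclidean_space) encoding \<Rightarrow>
     ('tr, 'a2::euclidean_space, 'm2, 'e2::euclidean_space) encoding \<Rightarrow>
     ('st, 'a3::euclidean_space, 'm3, 'e3::euclidean_space) encoding \<Rightarrow> 'l set \<Rightarrow>
     ('l \<Rightarrow> ('a1, 'm1, 'e1) form) \<Rightarrow> ('l \<Rightarrow> 'l \<Rightarrow> ('a2, 'm2, 'e2) form) \<Rightarrow>
     ('l \<Rightarrow> ('a3, 'm3, 'e3) form) \<Rightarrow> bool" where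
  "noncontextual \<E> \<T> \<P> \<Lambda> \<xi> \<Gamma> \<mu> \<longleftrightarrow>
     (\<forall>l'\<in>\<Lambda>. zero_phase \<E> (\<xi> l')) \<and>
     (\<forall>l'\<in>\<Lambda>. \<forall>l\<in>\<Lambda>. zero_phase \<T> (\<Gamma> l' l)) \<and>
     (\<forall>l\<in>\<Lambda>. zero_phase \<P> (\<mu> l))"

definition connection_decomposition ::
    "('o, 'a::euclidean_space, 'm, 'e::euclidean_space) encoding \<Rightarrow>
     ('a, 'm, 'e) form \<Rightarrow> ('a, 'm, 'e) form \<Rightarrow> ('a, 'm, 'e) form \<Rightarrow> bool" where
  "connection_decomposition G v c \<omega> \<longleftrightarrow>
     c \<in> forms (shape G) 0 \<and> \<omega> \<in> forms (shape G) 1 \<and>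
     v = form_add (differential (shape G) 0 c) \<omega>"

definition contextual_curvature ::
    "('o, 'a::euclidean_space, 'm, 'e::euclidean_space) encoding \<Rightarrow>
     ('a, 'm, 'e) form \<Rightarrow> ('a, 'm, 'e) form" where
  "contextual_curvature G \<omega> = differential (shape G) 1 \<omega>"

end

theory Submission
  imports Defs
begin

text \<open>A valuation form $v = dc + \omega$ with $d\omega = 0$ has $\omega = df$ because $H^1 = 0$.  So
  $v$ is the sum of two exact forms, and by Stokes' theorem each of them vanishes on loops.  For
  smooth singular 1-simplices, Stokes' theorem is the fundamental theorem of calculus, applied to
  the composition of a 0-form with the path; the integrand is computed in one chart per point.\<close>

section \<open>Zero form, first cohomology and the simplicial case\<close>

lemma form_add_zero_left:
  assumes "\<alpha> \<in> forms M n"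
  shows "form_add (form_zero M) \<alpha> = \<alpha>"
  using assms by (cases M) auto

lemma Ck_on_zero: "Ck_on k (\<lambda>_. 0) S"
  by (induction k) (auto simp: frechet_derivative_const)

lemma smooth_on_zero: "smooth_on (\<lambda>_. 0) S"
  by (simp add: smooth_on_def Ck_on_zero)

lemma smooth_on_imp_differentiable:
  assumes "smooth_on f S" "x \<in> S"
  shows "f differentiable (at x)"
proof -
  have "Ck_on (Suc 0) f S" using assms(1) unfolding smooth_on_def by blast
  then show ?thesis using assms(2) by simp
qed

lemma form_zero_in_forms: "form_zero M \<in> forms M n"
proof (cases M)
  case (Discrete K ori)
  then show ?thesis by (auto simp: simplicial_cochains_def)
next
  case (Continuous X A)
  then show ?thesis
    by (auto simp: smooth_forms_def smooth_on_zero module_hom_zero linear_iff)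
qed

lemma differential_zero: "differential M n (form_zero M) = form_zero M"
  by (cases M)
    (auto simp: simplicial_coboundary_def exterior_derivative_def frechet_derivative_const
      intro!: ext)

lemma form_zero_exact: "form_zero M \<in> exact_forms1 M"
  unfolding exact_forms1_def using form_zero_in_forms differential_zero by (metis image_eqI)

text \<open>Argued with cosets directly: in a trivial quotient the coset of \<open>\<omega>\<close>
  is the unit, which is \<open>exact_forms1 M\<close> itself. Since the zero form is exact,
  \<open>\<omega>\<close> lies in its own coset, hence is exact.\<close>

lemma closed_form_exact:
  assumes "trivial_group (de_Rham_cohomology1 M)" and "\<omega> \<in> closed_forms1 M"
  shows "\<omega> \<in> exact_forms1 M"
proof -
  let ?G = "\<lparr>carrier = closed_forms1 M, monoid.mult = form_add, one = form_zero M\<rparr>"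
  have "exact_forms1 M #>\<^bsub>?G\<^esub> \<omega> \<in> carrier (de_Rham_cohomology1 M)"
    using assms(2) by (auto simp: de_Rham_cohomology1_def FactGroup_def RCOSETS_def)
  also have "\<dots> = {exact_forms1 M}"
    using assms(1) by (simp add: trivial_group_def de_Rham_cohomology1_def FactGroup_def)
  finally have "exact_forms1 M #>\<^bsub>?G\<^esub> \<omega> = exact_forms1 M" by simp
  moreover have "form_add (form_zero M) \<omega> \<in> exact_forms1 M #>\<^bsub>?G\<^esub> \<omega>"
    using form_zero_exact by (auto simp: r_coset_def)
  moreover have "form_add (form_zero M) \<omega> = \<omega>"
    using assms(2) by (intro form_add_zero_left[of _ _ 1]) (simp add: closed_forms1_def)
  ultimately show ?thesis by simp
qed

text \<open>The coboundary is precomposition with the boundary, so on a loop it evaluates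
  \<open>w\<close> at the zero chain, and linearity makes this 0.\<close>

lemma simplicial_stokes:
  assumes "w \<in> simplicial_cochains K 0" "c \<in> simplicial_chains K 1"
    and "simplicial_boundary ori c = (\<lambda>_. 0)"
  shows "simplicial_coboundary K ori 0 w c = 0"
proof -
  have z: "(\<lambda>_. 0) \<in> simplicial_chains K 0" by (simp add: simplicial_chains_def)
  have "w (\<lambda>S. a * c S + b * c' S) = a * w c + b * w c'"
    if "c \<in> simplicial_chains K 0" "c' \<in> simplicial_chains K 0" for c c' a b
    using assms(1) that unfolding simplicial_cochains_def by blast
  from this[OF z z, of 0 0] have "w (\<lambda>_. 0) = 0" by simp
  then show ?thesis using assms(2,3) by (simp add: simplicial_coboundary_def)
qed

section \<open>Stokes' theorem along one smooth singular 1-simplex\<close>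

context
  fixes X :: "'m topology" and A :: "('m, 'e::euclidean_space) chart set"
  assumes man: "smooth_manifold X A"
begin

lemma chart_cover: "x \<in> topspace X \<Longrightarrow> \<exists>h\<in>A. x \<in> fst h"
  using man by (auto simp: smooth_manifold_def)

lemma chart_inj_on:
  assumes "h \<in> A" shows "inj_on (snd h) (fst h)"
proof -
  have o: "openin X (fst h)"
    and hm: "homeomorphic_map (subtopology X (fst h)) (top_of_set (chart_image h)) (snd h)"
    using man assms by (auto simp: smooth_manifold_def)
  have "topspace (subtopology X (fst h)) = fst h"
    using openin_subset[OF o] by auto
  then show ?thesis using homeomorphic_imp_injective_map[OF hm] by simp
qed

lemma transition_apply:
  assumes "h \<in> A" "x \<in> fst h"
  shows "transition h h' (snd h x) = snd h' x"
  using assms chart_inj_on by (simp add: transition_def)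

text \<open>A chart is an open map onto its image, and that image is open in the model
  space.\<close>

lemma open_chart_overlap:
  assumes "h \<in> A" "h' \<in> A" shows "open (snd h ` (fst h \<inter> fst h'))"
proof -
  have o: "openin X (fst h)" "openin X (fst h')" "open (chart_image h)"
    and hm: "homeomorphic_map (subtopology X (fst h)) (top_of_set (chart_image h)) (snd h)"
    using man assms by (auto simp: smooth_manifold_def)
  have "openin (subtopology X (fst h)) (fst h \<inter> fst h')"
    using o(2) by (auto simp: openin_subtopology)
  then have "openin (top_of_set (chart_image h)) (snd h ` (fst h \<inter> fst h'))"
    using homeomorphic_imp_open_map[OF hm] by (simp add: open_map_def)
  then show ?thesis using o(3) openin_open_eq by blast
qed

text \<open>Smoothness of \<open>\<sigma>\<close> at \<open>t\<close> provides a local extension in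
  some chart only. Composing with a transition map carries it to any chart \<open>h\<close> around
  \<open>\<sigma> t\<close>.\<close>

lemma smooth_path_in_chart:
  assumes \<sigma>: "smooth_singular_simplex1 X A \<sigma>" and t: "t \<in> {0..1}"
    and h: "h \<in> A" "\<sigma> t \<in> fst h"
  obtains d where "d > 0" "\<And>s. s \<in> {0..1} \<Longrightarrow> dist s t < d \<Longrightarrow> \<sigma> s \<in> fst h"
    "(snd h \<circ> \<sigma>) differentiable (at t within {0..1})"
proof -
  from \<sigma>[unfolded smooth_singular_simplex1_def, THEN conjunct2, THEN conjunct2, THEN bspec, OF t]
  obtain h' J g where h': "h' \<in> A" and J: "open J" "t \<in> J" "\<sigma> ` (J \<inter> {0..1}) \<subseteq> fst h'"
    and g: "smooth_on g J" "\<forall>s\<in>J \<inter> {0..1}. g s = snd h' (\<sigma> s)"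
    by (elim bexE exE conjE) (rule that)
  \<comment> \<open>The domain of the transition from \<open>h'\<close> to \<open>h\<close>, in the
    coordinates of \<open>h'\<close>; by continuity \<open>g\<close> stays inside it near
    \<open>t\<close>.\<close>
  define U where "U = snd h' ` (fst h' \<inter> fst h)"
  have "open U" unfolding U_def by (rule open_chart_overlap[OF h' h(1)])
  moreover have "continuous_on J g"
    using g(1) unfolding smooth_on_def by (metis Ck_on.simps(1))
  ultimately have "open (J \<inter> g -` U)"
    using J(1) by (simp add: continuous_on_open_vimage Int_commute)
  moreover have gt: "g t \<in> U"
  proof -
    have "t \<in> J \<inter> {0..1}" using J(2) t by blast
    then have "g t = snd h' (\<sigma> t)" "\<sigma> t \<in> fst h'" using bspec[OF g(2)] J(3) by blast+
    then show ?thesis unfolding U_def using h(2) by blast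
  qed
  then have "t \<in> J \<inter> g -` U" using J(2) by simp
  ultimately obtain d where d: "d > 0" "ball t d \<subseteq> J \<inter> g -` U"
    by (meson open_contains_ball)
  have near: "\<sigma> s \<in> fst h \<and> (transition h' h \<circ> g) s = (snd h \<circ> \<sigma>) s"
    if s: "s \<in> {0..1}" "dist s t < d" for s
  proof -
    have sJ: "s \<in> J" "g s \<in> U" using d(2) s(2) by (auto simp: dist_commute subset_iff)
    then have fs: "\<sigma> s \<in> fst h'" using J(3) s(1) by blast
    have gs: "g s = snd h' (\<sigma> s)" using sJ(1) s(1) by (intro bspec[OF g(2)]) blast
    \<comment> \<open>Membership of \<open>g s\<close> in \<open>U\<close> only yields a point of
      the overlap with the same coordinates as \<open>\<sigma> s\<close>; injectivity of
      \<open>h'\<close> identifies the two.\<close>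
    obtain m where m: "m \<in> fst h'" "m \<in> fst h" "snd h' (\<sigma> s) = snd h' m"
      using sJ(2) gs by (auto simp: U_def)
    have "\<sigma> s = m" using inj_onD[OF chart_inj_on[OF h'] m(3) fs m(1)] .
    then show ?thesis using m gs transition_apply[OF h' fs] by simp
  qed
  have "g differentiable (at t)" using smooth_on_imp_differentiable[OF g(1) J(2)] .
  moreover have "smooth_on (transition h' h) U"
    using man h h' by (simp add: smooth_manifold_def U_def)
  then have "transition h' h differentiable (at (g t))"
    using gt by (rule smooth_on_imp_differentiable)
  ultimately have "(transition h' h \<circ> g) differentiable (at t)"
    by (rule differentiable_chain_at)
  then have "(transition h' h \<circ> g) differentiable (at t within {0..1})"
    by (rule differentiable_at_withinI)
  \<comment> \<open>The composite with \<open>g\<close> is differentiable on both sides of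
    \<open>t\<close>, but it agrees with the path only inside the unit interval, so the derivative
    at the end points is one-sided.\<close>
  then have "(snd h \<circ> \<sigma>) differentiable (at t within {0..1})"
    using differentiable_transform_within[OF _ d(1) t] near by blast
  then show thesis using that d(1) near by blast
qed

text \<open>The function on the manifold that a 0-form represents.\<close>

definition form_value0 :: "(('m, 'e) chart \<Rightarrow> 'e \<Rightarrow> 'e list \<Rightarrow> real) \<Rightarrow> 'm \<Rightarrow> real" where
  "form_value0 f x = (let h = (SOME h. h \<in> A \<and> x \<in> fst h) in f h (snd h x) [])"

text \<open>For an empty list of tangent vectors, the pullback rule between charts just says that
  the values agree, so the chosen chart is immaterial.\<close>

lemma form_value0_eq:
  assumes f: "f \<in> smooth_forms A 0" and h: "h \<in> A" "x \<in> fst h"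
  shows "form_value0 f x = f h (snd h x) []"
proof -
  define k where "k = (SOME h. h \<in> A \<and> x \<in> fst h)"
  have k: "k \<in> A" "x \<in> fst k"
    unfolding k_def using someI[of "\<lambda>h. h \<in> A \<and> x \<in> fst h" h] h by auto
  have "\<forall>h\<in>A. \<forall>h'\<in>A. \<forall>x\<in>snd h ` (fst h \<inter> fst h'). \<forall>vs. f h x vs =
      f h' (transition h h' x) (map (frechet_derivative (transition h h') (at x)) vs)"
    using f by (simp add: smooth_forms_def)
  then have "f k (snd k x) [] = f h (transition k h (snd k x))
      (map (frechet_derivative (transition k h) (at (snd k x))) [])"
    using h k by blast
  then show ?thesis
    unfolding form_value0_def Let_def k_def[symmetric] using transition_apply[OF k] by simp
qed

text \<open>Stated with \<open>has_integral\<close> so that integrability is included and two such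
  integrals can be added.\<close>

lemma has_integral_exterior_derivative0:
  assumes f: "f \<in> smooth_forms A 0" and \<sigma>: "smooth_singular_simplex1 X A \<sigma>"
  shows "((\<lambda>t. let h = (SOME h. h \<in> A \<and> \<sigma> t \<in> fst h)
       in exterior_derivative A f h (snd h (\<sigma> t))
            [vector_derivative (snd h \<circ> \<sigma>) (at t within {0..1})])
     has_integral (form_value0 f (\<sigma> 1) - form_value0 f (\<sigma> 0))) {0..1}"
proof (rule fundamental_theorem_of_calculus[of 0 1 "\<lambda>t. form_value0 f (\<sigma> t)"])
  fix t :: real assume t: "t \<in> {0..1}"
  \<comment> \<open>The chart that the integrand selects at this \<open>t\<close>. It may change
    with \<open>t\<close>, which is harmless because differentiation at \<open>t\<close> needs it
    only near \<open>t\<close>.\<close>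
  define h where "h = (SOME h. h \<in> A \<and> \<sigma> t \<in> fst h)"
  define w where "w = vector_derivative (snd h \<circ> \<sigma>) (at t within {0..1})"
  have "\<sigma> t \<in> topspace X" using \<sigma> t by (auto simp: smooth_singular_simplex1_def)
  from someI_ex[OF chart_cover[OF this, unfolded Bex_def]]
  have h: "h \<in> A" "\<sigma> t \<in> fst h" unfolding h_def by blast+
  then have hx: "snd h (\<sigma> t) \<in> chart_image h" by (simp add: chart_image_def)
  obtain d where d: "d > 0" "\<And>s. s \<in> {0..1} \<Longrightarrow> dist s t < d \<Longrightarrow> \<sigma> s \<in> fst h"
    and diff: "(snd h \<circ> \<sigma>) differentiable (at t within {0..1})"
    using smooth_path_in_chart[OF \<sigma> t h] by metis
  have w: "((snd h \<circ> \<sigma>) has_vector_derivative w) (at t within {0..1})"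
    unfolding w_def using diff vector_derivative_works by blast
  define D where "D = frechet_derivative (\<lambda>y. f h y []) (at (snd h (\<sigma> t)))"
  have "smooth_on (\<lambda>y. f h y []) (chart_image h)"
    using f h by (simp add: smooth_forms_def)
  then have "((\<lambda>y. f h y []) has_derivative D) (at ((snd h \<circ> \<sigma>) t))"
    using smooth_on_imp_differentiable[OF _ hx] frechet_derivative_works D_def by fastforce
  then have "(((\<lambda>y. f h y []) \<circ> (snd h \<circ> \<sigma>)) has_vector_derivative D w) (at t within {0..1})"
    by (rule vector_derivative_diff_chain_within[OF w has_derivative_at_withinI])
  \<comment> \<open>Within distance \<open>d\<close> of \<open>t\<close> the path remains in the
    domain of \<open>h\<close>, where the 0-form can be read off in that single chart.\<close>
  then have "((\<lambda>t. form_value0 f (\<sigma> t)) has_vector_derivative D w) (at t within {0..1})"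
    by (rule has_vector_derivative_transform_within[OF _ d(1) t])
      (simp add: form_value0_eq[OF f h(1)] d(2))
  \<comment> \<open>With one tangent vector only the summand for index 0 occurs, and omitting that
    vector leaves the empty list.\<close>
  moreover have "exterior_derivative A f h (snd h (\<sigma> t)) [w] = D w"
    using h hx by (simp add: exterior_derivative_def omit_def D_def)
  ultimately show "((\<lambda>t. form_value0 f (\<sigma> t)) has_vector_derivative
      (let h = (SOME h. h \<in> A \<and> \<sigma> t \<in> fst h)
       in exterior_derivative A f h (snd h (\<sigma> t))
            [vector_derivative (snd h \<circ> \<sigma>) (at t within {0..1})])) (at t within {0..1})"
    unfolding Let_def h_def[symmetric] w_def[symmetric] by simp
qed simp

text \<open>Both exact summands of a valuation form are integrated together, since the pairing is
  taken with their sum as one form.\<close>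

lemma form_integral1_add_exact:
  assumes f: "f \<in> smooth_forms A 0" and g: "g \<in> smooth_forms A 0"
    and \<sigma>: "smooth_singular_simplex1 X A \<sigma>"
  shows "form_integral1 A
      (\<lambda>h x vs. exterior_derivative A f h x vs + exterior_derivative A g h x vs) \<sigma> =
    (form_value0 f (\<sigma> 1) + form_value0 g (\<sigma> 1)) - (form_value0 f (\<sigma> 0) + form_value0 g (\<sigma> 0))"
  using has_integral_add[OF has_integral_exterior_derivative0[OF f \<sigma>]
      has_integral_exterior_derivative0[OF g \<sigma>]]
  unfolding form_integral1_def Let_def by (simp add: integral_unique)

end

section \<open>Vanishing on loops and noncontextuality\<close>

text \<open>Regrouping the sum by end points turns the coefficient of \<open>\<phi> x\<close> into
  the boundary coefficient at \<open>x\<close>, which is 0 for a loop.\<close>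

lemma singular_loop_sum_zero:
  assumes fin: "finite {\<sigma>. c \<sigma> \<noteq> 0}" and loop: "singular_boundary1 c = (\<lambda>_. 0)"
  shows "(\<Sum>\<sigma> | c \<sigma> \<noteq> 0. c \<sigma> * (\<phi> (\<sigma> 1) - \<phi> (\<sigma> 0))) = 0"
proof -
  let ?C = "{\<sigma>. c \<sigma> \<noteq> 0}"
  \<comment> \<open>All end points of the simplices in the chain: a finite set, so that the two
    summations can be exchanged.\<close>
  define E where "E = (\<lambda>\<sigma>. \<sigma> 1) ` ?C \<union> (\<lambda>\<sigma>. \<sigma> 0) ` ?C"
  have E: "finite E" unfolding E_def using fin by blast
  have "(\<Sum>\<sigma>\<in>?C. c \<sigma> * (\<phi> (\<sigma> 1) - \<phi> (\<sigma> 0))) =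
      (\<Sum>\<sigma>\<in>?C. \<Sum>x\<in>E. \<phi> x * (c \<sigma> * (of_bool (\<sigma> 1 = x) - of_bool (\<sigma> 0 = x))))"
  proof (rule sum.cong[OF refl])
    fix \<sigma> assume "\<sigma> \<in> ?C"
    then have e: "\<sigma> 1 \<in> E" "\<sigma> 0 \<in> E" by (auto simp: E_def)
    have ev: "(\<Sum>x\<in>E. \<phi> x * of_bool (y = x)) = \<phi> y" if "y \<in> E" for y
      using E that by (simp add: of_bool_def if_distrib[of "\<lambda>z. _ * z"] cong: if_cong)
    have "(\<Sum>x\<in>E. \<phi> x * (c \<sigma> * (of_bool (\<sigma> 1 = x) - of_bool (\<sigma> 0 = x)))) =
        c \<sigma> * ((\<Sum>x\<in>E. \<phi> x * of_bool (\<sigma> 1 = x)) - (\<Sum>x\<in>E. \<phi> x * of_bool (\<sigma> 0 = x)))"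
      by (simp only: sum_subtractf[symmetric] sum_distrib_left) (simp only: algebra_simps)
    then show "c \<sigma> * (\<phi> (\<sigma> 1) - \<phi> (\<sigma> 0)) =
        (\<Sum>x\<in>E. \<phi> x * (c \<sigma> * (of_bool (\<sigma> 1 = x) - of_bool (\<sigma> 0 = x))))"
      using ev[OF e(1)] ev[OF e(2)] by simp
  qed
  also have "\<dots> = (\<Sum>x\<in>E. \<phi> x * singular_boundary1 c x)"
    unfolding singular_boundary1_def sum_distrib_left by (rule sum.swap)
  finally show ?thesis using loop by simp
qed

lemma pairing1_add_exact_loop:
  assumes M: "geometric_space M" and f: "f \<in> forms M 0" and g: "g \<in> forms M 0"
    and \<gamma>: "\<gamma> \<in> loops M"
  shows "pairing1 M (form_add (differential M 0 f) (differential M 0 g)) \<gamma> = 0"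
proof (cases M)
  case (Discrete K ori)
  then show ?thesis using f g \<gamma> by (auto simp: simplicial_stokes)
next
  case (Continuous X A)
  obtain a where a: "f = Smooth_Form a" "a \<in> smooth_forms A 0" using f Continuous by auto
  obtain b where b: "g = Smooth_Form b" "b \<in> smooth_forms A 0" using g Continuous by auto
  obtain c where c: "\<gamma> = Singular_Chain c" "c \<in> smooth_chains1 X A"
    "singular_boundary1 c = (\<lambda>_. 0)"
    using \<gamma> Continuous by auto
  have man: "smooth_manifold X A" using M Continuous by simp
  \<comment> \<open>A potential of the whole 1-form: its integral along a path is the difference of
    \<open>?\<phi>\<close> at the end points.\<close>
  let ?\<phi> = "\<lambda>x. form_value0 A a x + form_value0 A b x"
  have "pairing1 M (form_add (differential M 0 f) (differential M 0 g)) \<gamma> =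
      (\<Sum>\<sigma> | c \<sigma> \<noteq> 0. c \<sigma> * (?\<phi> (\<sigma> 1) - ?\<phi> (\<sigma> 0)))"
    unfolding Continuous a(1) b(1) c(1)
    using c(2) form_integral1_add_exact[OF man a(2) b(2)]
    by (auto simp: smooth_chains1_def intro!: sum.cong)
  also have "\<dots> = 0"
    using singular_loop_sum_zero[of c ?\<phi>] c by (simp add: smooth_chains1_def)
  finally show ?thesis .
qed

text \<open>Stated for an arbitrary encoding, to serve effects, transformations and states
  alike.\<close>

lemma zero_phase_if_flat:
  assumes G: "geometric_encoding G" and dec: "connection_decomposition G v c \<omega>"
    and H1: "trivial_group (de_Rham_cohomology1 (shape G))"
    and flat: "contextual_curvature G \<omega> = form_zero (shape G)"
  shows "zero_phase G v"
proof -
  have "\<omega> \<in> closed_forms1 (shape G)"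
    using dec flat
    by (simp add: closed_forms1_def connection_decomposition_def contextual_curvature_def)
  then obtain f where "f \<in> forms (shape G) 0" "\<omega> = differential (shape G) 0 f"
    using closed_form_exact[OF H1] by (auto simp: exact_forms1_def)
  then show ?thesis
    using G dec pairing1_add_exact_loop
    unfolding zero_phase_def connection_decomposition_def geometric_encoding_def by blast
qed

theorem theorem9:
  fixes \<E> :: "('eff::euclidean_space, 'a1::euclidean_space, 'm1, 'e1::euclidean_space) encoding"
    and \<T> :: "('tr::euclidean_space, 'a2::euclidean_space, 'm2, 'e2::euclidean_space) encoding"
    and \<P> :: "('st::euclidean_space, 'a3::euclidean_space, 'm3, 'e3::euclidean_space) encoding"
    and p :: "'eff \<Rightarrow> 'tr \<Rightarrow> 'st \<Rightarrow> real"
    and \<Lambda> :: "'l set"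
    and \<xi> c\<^sub>\<xi> \<omega>\<^sub>\<xi> :: "'l \<Rightarrow> ('a1, 'm1, 'e1) form"
    and \<Gamma> c\<^sub>\<Gamma> \<omega>\<^sub>\<Gamma> :: "'l \<Rightarrow> 'l \<Rightarrow> ('a2, 'm2, 'e2) form"
    and \<mu> c\<^sub>\<mu> \<omega>\<^sub>\<mu> :: "'l \<Rightarrow> ('a3, 'm3, 'e3) form"
  assumes "ontic_representation \<E> \<T> \<P> p \<Lambda> \<xi> \<Gamma> \<mu>"
    and "\<And>l'. l' \<in> \<Lambda> \<Longrightarrow> connection_decomposition \<E> (\<xi> l') (c\<^sub>\<xi> l') (\<omega>\<^sub>\<xi> l')"
    and "\<And>l' l. l' \<in> \<Lambda> \<Longrightarrow> l \<in> \<Lambda> \<Longrightarrow>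
           connection_decomposition \<T> (\<Gamma> l' l) (c\<^sub>\<Gamma> l' l) (\<omega>\<^sub>\<Gamma> l' l)"
    and "\<And>l. l \<in> \<Lambda> \<Longrightarrow> connection_decomposition \<P> (\<mu> l) (c\<^sub>\<mu> l) (\<omega>\<^sub>\<mu> l)"
    and "trivial_group (de_Rham_cohomology1 (shape \<E>))"
    and "trivial_group (de_Rham_cohomology1 (shape \<T>))"
    and "trivial_group (de_Rham_cohomology1 (shape \<P>))"
    and "\<And>l'. l' \<in> \<Lambda> \<Longrightarrow> contextual_curvature \<E> (\<omega>\<^sub>\<xi> l') = form_zero (shape \<E>)"
    and "\<And>l' l. l' \<in> \<Lambda> \<Longrightarrow> l \<in> \<Lambda> \<Longrightarrow>
           contextual_curvature \<T> (\<omega>\<^sub>\<Gamma> l' l) = form_zero (shape \<T>)"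
    and "\<And>l. l \<in> \<Lambda> \<Longrightarrow> contextual_curvature \<P> (\<omega>\<^sub>\<mu> l) = form_zero (shape \<P>)"
  shows "noncontextual \<E> \<T> \<P> \<Lambda> \<xi> \<Gamma> \<mu>"
proof -
  have G: "geometric_encoding \<E>" "geometric_encoding \<T>" "geometric_encoding \<P>"
    using assms(1) by (simp_all add: ontic_representation_def)
  show ?thesis
    unfolding noncontextual_def
    using zero_phase_if_flat[OF G(1) assms(2,5,8)] zero_phase_if_flat[OF G(2) assms(3,6,9)]
      zero_phase_if_flat[OF G(3) assms(4,7,10)]
    by simp
qed

end
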